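(* Let $d_n^{\#2}$ be the number of rows with the value true in the truth tables of all the bracketed m-implications with $n$ variables, type 1, case 2. Then, as $n\to\infty$, $$d_n^{\#2} \sim \left(\frac{11\sqrt{10}-30}{20}\right)\frac{2^{3n-2}}{\sqrt{\pi n^3}}.$$
   Context: The m-implication of type 1 is the connective $\psi\rightharpoonup\phi\equiv\psi\to\neg\phi$, which has value 0 (false) exactly when $\psi$ and $\phi$ both have value 1 (true), and value 1 otherwise. A bracketed formula with $n$ distinct variables is obtained from $p_1\rightharpoonup p_2\rightharpoonup\cdots\rightharpoonup p_n$ (variables in this fixed order) by fully inserting brackets; for $n\ge2$ it has the form $\psi\rightharpoonup\phi$ with $\psi$ a bracketing of $p_1\rightharpoonup\cdots\rightharpoonup p_i$ and $\phi$ a bracketing of $p_{i+1}\rightharpoonup\cdots\rightharpoonup p_n$ for some $1\le i\le n-1$. A row is a pair consisting of a bracketed formula and a valuation of $p_1,\dots,p_n$ in $\{0,1\}$. Case 2 means: for $n\ge2$, $d_n^{\#2}$ counts the rows (over all bracketed formulae in $n$ variables) for which $\psi$ has value 0 and $\phi$ has value 1 (so that $\psi\rightharpoonup\phi$ is true). $u_n\sim v_n$ means $u_n/v_n\to1$. *)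

theory Defs
  imports "HOL-Analysis.Analysis" "HOL-Library.Landau_Symbols"
begin

unbundle asymp_equiv_syntax

datatype formula =
  Var nat
| MImp formula formula  (infixr \<open>\<rightharpoonup>\<close> 60)

text \<open>The m-implication of type 1 is \<open>\<psi> \<longrightarrow> \<not> \<phi>\<close>; the truth values 1 and 0 are \<open>True\<close> and \<open>False\<close>.\<close>

fun val :: "(nat \<Rightarrow> bool) \<Rightarrow> formula \<Rightarrow> bool" where
  "val v (Var i) = v i"
| "val v (\<psi> \<rightharpoonup> \<phi>) = (val v \<psi> \<longrightarrow> \<not> val v \<phi>)"

text \<open>\<open>bracketing i j A\<close>: the formula \<open>A\<close> arises from \<open>p\<^sub>i \<rightharpoonup> \<rightharpoonup> \<dots> \<rightharpoonup> p\<^sub>j\<close>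
  by fully inserting brackets.\<close>

inductive bracketing :: "nat \<Rightarrow> nat \<Rightarrow> formula \<Rightarrow> bool" where
  Var: "bracketing i i (Var i)"
| MImp: "bracketing i k \<psi> \<Longrightarrow> bracketing (Suc k) j \<phi> \<Longrightarrow> bracketing i j (\<psi> \<rightharpoonup> \<phi>)"

text \<open>Valuations of \<open>p\<^sub>1, \<dots>, p\<^sub>n\<close> are extensional functions, so that rows that agree on these
  variables are counted once.\<close>

definition rows :: "nat \<Rightarrow> (formula \<times> (nat \<Rightarrow> bool)) set" where
  "rows n = {A. bracketing 1 n A} \<times> ({1..n} \<rightarrow>\<^sub>E UNIV)"

text \<open>The count is meant for \<open>n \<ge> 2\<close>; it is \<open>0\<close> for smaller \<open>n\<close>.\<close>

definition d_case2 :: "nat \<Rightarrow> nat" where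
  "d_case2 n = card {(A, v) \<in> rows n. \<exists>\<psi> \<phi>. A = (\<psi> \<rightharpoonup> \<phi>) \<and> \<not> val v \<psi> \<and> val v \<phi>}"

end

theory Submission
  imports Defs
begin

text \<open>Let \<open>g\<close>, \<open>t\<close>, \<open>f\<close> be the numbers of all, true and false rows in \<open>n\<close> variables, divided by \<open>8 ^ n\<close>.
  Up to corrections at \<open>n \<le> 1\<close>, \<open>g = g * g\<close> and \<open>f = t * t\<close> for convolutions, and the rows of case 2
  are counted by \<open>f * t\<close>. The sequence \<open>g\<close> is explicit, \<open>g n ~ 1 / (4 sqrt (pi n\<^sup>3))\<close>, with sum \<open>1/2\<close>.
  Hence \<open>g * g = g\<close> says that a convolution of sequences dominated by \<open>g\<close> is asymptotically
  determined by its two ends: if \<open>a ~ \<alpha> g\<close> and \<open>b ~ \<beta> g\<close>, then \<open>a * b ~ (\<beta> \<Sum>a + \<alpha> \<Sum>b) g\<close>.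

  Applied to \<open>t + t * t = g\<close>, this forces \<open>t ~ \<lambda> g\<close> with \<open>\<lambda> (1 + 2 S) = 1\<close> and \<open>S = \<Sum>t\<close>. The limit exists
  because the asymptotic oscillation of \<open>t / g\<close> is contracted by the factor \<open>2 S < 1\<close>, where
  \<open>S + S\<^sup>2 + 1/8 = 1/2\<close> gives \<open>S = (sqrt 10 - 2) / 4\<close>.\<close>

subsection \<open>Rows and their convolution recurrences\<close>

lemma bracketing_le: "bracketing i j A \<Longrightarrow> i \<le> j"
  by (induction rule: bracketing.induct) auto

text \<open>By induction the left subformula fixes the split point, and then the right one fixes the
  end. This keeps the rows split at different points apart.\<close>

lemma bracketing_right_unique: "bracketing i j A \<Longrightarrow> bracketing i k A \<Longrightarrow> j = k"
proof (induction arbitrary: k rule: bracketing.induct)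
  case (Var i)
  then show ?case by (auto elim: bracketing.cases)
next
  case (MImp i m \<psi> j \<phi>)
  from MImp.prems show ?case
    by cases (use MImp.IH in blast)
qed

lemma bracketing_Var_iff: "bracketing i i A \<longleftrightarrow> A = Var i"
proof
  assume "bracketing i i A"
  then show "A = Var i"
    by cases (auto dest!: bracketing_le)
qed (auto intro: bracketing.Var)

lemma finite_bracketing: "finite {A. bracketing i j A}"
proof (induction "Suc j - i" arbitrary: i j rule: less_induct)
  case less
  have "{A. bracketing i j A} \<subseteq>
      insert (Var i) (\<Union>k\<in>{i..<j}. (\<lambda>(\<psi>, \<phi>). \<psi> \<rightharpoonup> \<phi>) `
        ({A. bracketing i k A} \<times> {A. bracketing (Suc k) j A}))"
  proof
    fix A assume "A \<in> {A. bracketing i j A}"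
    then have "bracketing i j A" by simp
    then show "A \<in> insert (Var i) (\<Union>k\<in>{i..<j}. (\<lambda>(\<psi>, \<phi>). \<psi> \<rightharpoonup> \<phi>) `
        ({A. bracketing i k A} \<times> {A. bracketing (Suc k) j A}))"
    proof cases
      case (MImp k \<psi> \<phi>)
      then have "k \<in> {i..<j}" by (auto dest: bracketing_le)
      with MImp show ?thesis by blast
    qed auto
  qed
  moreover have "finite \<dots>"
    using less by (intro finite.insertI finite_UN_I finite_imageI finite_cartesian_product) auto
  ultimately show ?case by (rule finite_subset)
qed

section \<open>Cutting rows at the main connective and gluing them back\<close>

lemma val_cong:
  "bracketing i j A \<Longrightarrow> (\<And>x. i \<le> x \<Longrightarrow> x \<le> j \<Longrightarrow> v x = w x) \<Longrightarrow> val v A = val w A"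
proof (induction rule: bracketing.induct)
  case (MImp i k \<psi> j \<phi>)
  then have "i \<le> k" "Suc k \<le> j" by (auto dest: bracketing_le)
  with MImp show ?case by auto
qed auto

text \<open>The left end \<open>i\<close> is arbitrary because a right subformula does not start at
  the first variable.\<close>

definition truth_rows :: "nat \<Rightarrow> nat \<Rightarrow> bool \<Rightarrow> (formula \<times> (nat \<Rightarrow> bool)) set" where
  "truth_rows i j b = {(A, v). bracketing i j A \<and> v \<in> {i..j} \<rightarrow>\<^sub>E UNIV \<and> val v A = b}"

definition split_rows :: "nat \<Rightarrow> nat \<Rightarrow> bool \<Rightarrow> bool \<Rightarrow> (formula \<times> (nat \<Rightarrow> bool)) set" where
  "split_rows i j p q = {(A, v). bracketing i j A \<and> v \<in> {i..j} \<rightarrow>\<^sub>E UNIV \<and>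
     (\<exists>\<psi> \<phi>. A = (\<psi> \<rightharpoonup> \<phi>) \<and> val v \<psi> = p \<and> val v \<phi> = q)}"

lemma finite_valuations: "finite ({i..j} \<rightarrow>\<^sub>E (UNIV :: bool set))" for i j :: nat
  by (intro finite_PiE) auto

lemma finite_truth_rows: "finite (truth_rows i j b)"
  by (rule finite_subset[OF _ finite_cartesian_product[OF finite_bracketing finite_valuations]])
    (auto simp: truth_rows_def)

lemma finite_split_rows: "finite (split_rows i j p q)"
  by (rule finite_subset[OF _ finite_cartesian_product[OF finite_bracketing finite_valuations]])
    (auto simp: split_rows_def)

definition join_rows ::
  "nat \<Rightarrow> (formula \<times> (nat \<Rightarrow> bool)) \<times> (formula \<times> (nat \<Rightarrow> bool)) \<Rightarrow> formula \<times> (nat \<Rightarrow> bool)" where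
  "join_rows k = (\<lambda>((\<psi>, v), (\<phi>, w)). (\<psi> \<rightharpoonup> \<phi>, \<lambda>x. if x \<le> k then v x else w x))"

text \<open>The constructor returns both formulae. The glued valuation returns each part on its own
  interval, and extensionality fixes the part elsewhere.\<close>

lemma inj_on_join_rows: "inj_on (join_rows k) (truth_rows i k p \<times> truth_rows (Suc k) j q)"
proof (rule inj_onI)
  fix r s
  assume in_rows: "r \<in> truth_rows i k p \<times> truth_rows (Suc k) j q"
      "s \<in> truth_rows i k p \<times> truth_rows (Suc k) j q"
    and join: "join_rows k r = join_rows k s"
  obtain \<psi> v \<phi> w where r: "r = ((\<psi>, v), (\<phi>, w))" by (metis surj_pair)
  obtain \<psi>' v' \<phi>' w' where s: "s = ((\<psi>', v'), (\<phi>', w'))" by (metis surj_pair)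
  have rows: "(\<psi>, v) \<in> truth_rows i k p" "(\<phi>, w) \<in> truth_rows (Suc k) j q"
     "(\<psi>', v') \<in> truth_rows i k p" "(\<phi>', w') \<in> truth_rows (Suc k) j q"
    and eq: "join_rows k ((\<psi>, v), (\<phi>, w)) = join_rows k ((\<psi>', v'), (\<phi>', w'))"
    using in_rows join by (simp_all add: r s)
  have "(\<lambda>x. if x \<le> k then v x else w x) = (\<lambda>x. if x \<le> k then v' x else w' x)"
    using eq by (simp add: join_rows_def)
  then have pt: "(if x \<le> k then v x else w x) = (if x \<le> k then v' x else w' x)" for x
    by (rule fun_cong)
  have "v = v'"
  proof (rule PiE_ext[where k = "{i..k}" and s = "\<lambda>_. UNIV"])
    show "v \<in> {i..k} \<rightarrow>\<^sub>E UNIV" "v' \<in> {i..k} \<rightarrow>\<^sub>E UNIV"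
      using rows by (simp_all add: truth_rows_def)
    show "v x = v' x" if "x \<in> {i..k}" for x
      using pt[of x] that by simp
  qed
  moreover have "w = w'"
  proof (rule PiE_ext[where k = "{Suc k..j}" and s = "\<lambda>_. UNIV"])
    show "w \<in> {Suc k..j} \<rightarrow>\<^sub>E UNIV" "w' \<in> {Suc k..j} \<rightarrow>\<^sub>E UNIV"
      using rows by (simp_all add: truth_rows_def)
    show "w x = w' x" if "x \<in> {Suc k..j}" for x
      using pt[of x] that by simp
  qed
  ultimately show "r = s"
    using eq by (simp add: join_rows_def r s)
qed

lemma join_rows_in_split_rows:
  assumes "(\<psi>, v) \<in> truth_rows i k p" "(\<phi>, w) \<in> truth_rows (Suc k) j q"
  shows "join_rows k ((\<psi>, v), (\<phi>, w)) \<in> split_rows i j p q"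
proof -
  define u where "u = (\<lambda>x. if x \<le> k then v x else w x)"
  have br: "bracketing i k \<psi>" "bracketing (Suc k) j \<phi>"
    using assms by (auto simp: truth_rows_def)
  then have le: "i \<le> k" "Suc k \<le> j" by (auto dest: bracketing_le)
  have "u \<in> {i..j} \<rightarrow>\<^sub>E UNIV"
    \<comment> \<open>Below \<open>i\<close> the function \<open>v\<close> is used and above
      \<open>j\<close> the function \<open>w\<close>; both are undefined there.\<close>
    using assms le by (auto simp: truth_rows_def u_def PiE_iff extensional_def)
  moreover have "val u \<psi> = val v \<psi>" "val u \<phi> = val w \<phi>"
    by (rule val_cong[OF br(1)] val_cong[OF br(2)]; simp add: u_def)+
  ultimately show ?thesis
    using assms br by (auto simp: split_rows_def truth_rows_def join_rows_def u_def[symmetric]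
        intro: bracketing.MImp)
qed

lemma split_rows_eq_UN:
  "split_rows i j p q =
    (\<Union>k\<in>{i..<j}. join_rows k ` (truth_rows i k p \<times> truth_rows (Suc k) j q))"
proof (intro subset_antisym subsetI)
  fix r assume "r \<in> split_rows i j p q"
  then obtain \<psi> \<phi> u where r: "r = (\<psi> \<rightharpoonup> \<phi>, u)" and br: "bracketing i j (\<psi> \<rightharpoonup> \<phi>)"
    and u: "u \<in> {i..j} \<rightarrow>\<^sub>E UNIV" and pq: "val u \<psi> = p" "val u \<phi> = q"
    by (auto simp: split_rows_def)
  from br obtain k where k: "bracketing i k \<psi>" "bracketing (Suc k) j \<phi>"
    by cases
  then have le: "i \<le> k" "Suc k \<le> j" by (auto dest: bracketing_le)
  \<comment> \<open>Restricting to the two intervals inverts the gluing.\<close>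
  define v where "v = restrict u {i..k}"
  define w where "w = restrict u {Suc k..j}"
  have "val v \<psi> = val u \<psi>" "val w \<phi> = val u \<phi>"
    by (rule val_cong[OF k(1)] val_cong[OF k(2)]; simp add: v_def w_def)+
  then have "((\<psi>, v), (\<phi>, w)) \<in> truth_rows i k p \<times> truth_rows (Suc k) j q"
    using k pq by (auto simp: truth_rows_def v_def w_def)
  moreover have "u = (\<lambda>x. if x \<le> k then v x else w x)"
    using u le by (auto simp: v_def w_def fun_eq_iff PiE_iff extensional_def)
  then have "r = join_rows k ((\<psi>, v), (\<phi>, w))"
    by (simp add: r join_rows_def)
  ultimately show "r \<in> (\<Union>k\<in>{i..<j}. join_rows k ` (truth_rows i k p \<times> truth_rows (Suc k) j q))"
    using le by fastforce
qed (auto intro: join_rows_in_split_rows)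

text \<open>Images for different \<open>k\<close> are disjoint, since their left subformulae end at
  different variables.\<close>

lemma card_split_rows:
  "card (split_rows i j p q) =
    (\<Sum>k\<in>{i..<j}. card (truth_rows i k p) * card (truth_rows (Suc k) j q))"
proof -
  have "join_rows k ` (truth_rows i k p \<times> truth_rows (Suc k) j q) \<inter>
        join_rows l ` (truth_rows i l p \<times> truth_rows (Suc l) j q) = {}" if "k \<noteq> l" for k l
    using that by (auto simp: join_rows_def truth_rows_def dest: bracketing_right_unique)
  then have "card (split_rows i j p q) =
      (\<Sum>k\<in>{i..<j}. card (join_rows k ` (truth_rows i k p \<times> truth_rows (Suc k) j q)))"
    unfolding split_rows_eq_UN
    by (intro card_UN_disjoint ballI finite_imageI finite_cartesian_product finite_truth_rows) auto
  then show ?thesis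
    by (simp add: card_image[OF inj_on_join_rows] card_cartesian_product)
qed

lemma truth_rows_eq_UN:
  assumes "i < j"
  shows "truth_rows i j b = (\<Union>(p, q)\<in>{(p, q). (p \<longrightarrow> \<not> q) = b}. split_rows i j p q)"
proof -
  have "\<exists>\<psi> \<phi>. A = (\<psi> \<rightharpoonup> \<phi>)" if "bracketing i j A" for A
    using that assms by cases auto
  then show ?thesis
    by (fastforce simp: truth_rows_def split_rows_def)
qed

lemma card_truth_rows:
  assumes "i < j"
  shows "card (truth_rows i j b) =
    (\<Sum>(p, q)\<in>{(p, q). (p \<longrightarrow> \<not> q) = b}. card (split_rows i j p q))"
proof -
  have "split_rows i j p q \<inter> split_rows i j p' q' = {}" if "(p, q) \<noteq> (p', q')" for p q p' q'
    using that by (auto simp: split_rows_def)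
  then show ?thesis
    unfolding truth_rows_eq_UN[OF assms] case_prod_beta
    by (intro card_UN_disjoint ballI impI finite_split_rows) (simp_all add: prod_eq_iff)
qed

section \<open>Counts by number of variables\<close>

definition row_count :: "bool \<Rightarrow> nat \<Rightarrow> nat" where
  "row_count b n = card (truth_rows 1 n b)"

lemma truth_rows_empty: "j < i \<Longrightarrow> truth_rows i j b = {}"
  by (auto simp: truth_rows_def dest: bracketing_le)

lemma row_count_0 [simp]: "row_count b 0 = 0"
  by (simp add: row_count_def truth_rows_empty)

lemma card_truth_rows_single: "card (truth_rows i i b) = 1"
proof -
  have "truth_rows i i b = {(Var i, \<lambda>x. if x = i then b else undefined)}"
    by (auto simp: truth_rows_def bracketing_Var_iff fun_eq_iff PiE_iff extensional_def)
  then show ?thesis by simp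
qed

lemma row_count_1 [simp]: "row_count b (Suc 0) = 1"
  using card_truth_rows_single[of 1 b] by (simp add: row_count_def)

lemma sum_shift_convolution:
  fixes f :: "nat \<Rightarrow> nat \<Rightarrow> 'a::comm_monoid_add"
  shows "(\<Sum>k\<in>{i..<i+m}. f (Suc k - i) (i + m - k)) = (\<Sum>k\<in>{1..m}. f k (Suc m - k))"
  by (rule sum.reindex_bij_witness[where i = "\<lambda>k. i + k - 1" and j = "\<lambda>k. Suc k - i"])
    (auto simp: add.commute)

text \<open>Instead of renaming variables, strong induction on the interval length is used: the
  recurrence involves only lengths.\<close>

lemma card_truth_rows_shift: "card (truth_rows i j b) = row_count b (Suc j - i)"
proof (induction "Suc j - i" arbitrary: i j b rule: less_induct)
  case less
  consider "j < i" | "j = i" | "i < j" by linarith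
  then show ?case
  proof cases
    case 3
    \<comment> \<open>Stated for every interval as long as \<open>{i..j}\<close>, so that it applies
      both to \<open>{i..j}\<close> and to the interval of that length starting at 1.\<close>
    have step: "card (truth_rows i' j' b) =
        (\<Sum>(p, q)\<in>{(p, q). (p \<longrightarrow> \<not> q) = b}.
          \<Sum>k\<in>{1..j-i}. row_count p k * row_count q (Suc (j - i) - k))"
      if "j' = i' + (j - i)" for i' j'
    proof -
      have "card (split_rows i' j' p q) =
          (\<Sum>k\<in>{i'..<i' + (j - i)}. row_count p (Suc k - i') * row_count q (i' + (j - i) - k))" for p q
        unfolding card_split_rows that
      proof (intro sum.cong refl arg_cong2[of _ _ _ _ "(*)"])
        fix k assume k: "k \<in> {i'..<i' + (j - i)}"
        with 3 show "card (truth_rows i' k p) = row_count p (Suc k - i')"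
          by (intro less) auto
        from k 3 have "card (truth_rows (Suc k) (i' + (j - i)) q) = row_count q (Suc (i' + (j - i)) - Suc k)"
          by (intro less) auto
        then show "card (truth_rows (Suc k) (i' + (j - i)) q) = row_count q (i' + (j - i) - k)"
          by simp
      qed
      then show ?thesis
        using 3 that
        by (simp only: card_truth_rows sum_shift_convolution[where f = "\<lambda>a b. row_count _ a * row_count _ b"])
    qed
    have "row_count b (Suc j - i) = card (truth_rows 1 (Suc j - i) b)"
      by (simp add: row_count_def)
    then show ?thesis
      using 3 step[of j i] step[of "Suc j - i" 1] by (simp add: Suc_diff_le)
  qed (auto simp: truth_rows_empty card_truth_rows_single)
qed

definition conv :: "(nat \<Rightarrow> 'a::semiring_0) \<Rightarrow> (nat \<Rightarrow> 'a) \<Rightarrow> nat \<Rightarrow> 'a" where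
  "conv a b n = (\<Sum>k\<le>n. a k * b (n - k))"

lemma card_split_rows_conv: "card (split_rows 1 n p q) = conv (row_count p) (row_count q) n"
proof -
  have "card (split_rows 1 n p q) = (\<Sum>k\<in>{1..<n}. row_count p k * row_count q (n - k))"
    by (simp add: card_split_rows card_truth_rows_shift)
  also have "\<dots> = (\<Sum>k\<le>n. row_count p k * row_count q (n - k))"
    \<comment> \<open>The added end terms contain \<open>row_count\<close> at 0, which is 0.\<close>
    by (rule sum.mono_neutral_left) (auto simp: not_less_eq_eq Suc_le_eq)
  finally show ?thesis by (simp add: conv_def)
qed

lemma row_count_False: "n \<ge> 2 \<Longrightarrow> row_count False n = conv (row_count True) (row_count True) n"
proof -
  assume "n \<ge> 2"
  moreover have "{(p, q). (p \<longrightarrow> \<not> q) = False} = {(True, True)}" by auto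
  ultimately show ?thesis
    unfolding row_count_def[of False]
    by (subst card_truth_rows) (auto simp: card_split_rows_conv[unfolded One_nat_def])
qed

text \<open>Each of the four pairs of truth values of the subformulae gives one convolution, and
  together they make up the square of the sum.\<close>

lemma row_count_total:
  assumes "n \<ge> 2"
  shows "row_count True n + row_count False n =
    conv (\<lambda>k. row_count True k + row_count False k) (\<lambda>k. row_count True k + row_count False k) n"
proof -
  have "{(p, q). (p \<longrightarrow> \<not> q) = True} = {(True, False), (False, True), (False, False)}" by auto
  then have "row_count True n = conv (row_count True) (row_count False) n
      + conv (row_count False) (row_count True) n + conv (row_count False) (row_count False) n"
    unfolding row_count_def[of True n] using assms
    by (subst card_truth_rows) (auto simp: card_split_rows_conv[unfolded One_nat_def])
  then show ?thesis
    using row_count_False[OF assms]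
    by (simp add: conv_def algebra_simps sum.distrib)
qed

lemma d_case2_conv: "d_case2 n = conv (row_count False) (row_count True) n"
proof -
  have "{(A, v) \<in> rows n. \<exists>\<psi> \<phi>. A = (\<psi> \<rightharpoonup> \<phi>) \<and> \<not> val v \<psi> \<and> val v \<phi>} = split_rows 1 n False True"
    by (auto simp: rows_def split_rows_def)
  then show ?thesis
    by (simp only: d_case2_def card_split_rows_conv)
qed

subsection \<open>The total row counts\<close>

text \<open>The coefficients of \<open>(1 - sqrt (1 - x)) / 2\<close>, that is, the shifted Catalan numbers \<open>C (n - 1)\<close>
  divided by \<open>4 ^ n\<close>; they are the total row counts \<open>2 ^ n * C (n - 1)\<close> divided by \<open>8 ^ n\<close>.\<close>

definition catalan :: "nat \<Rightarrow> real" where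
  "catalan n = (if n = 0 then 0 else - ((1/2 gchoose n) * (-1) ^ n) / 2)"

lemma catalan_0 [simp]: "catalan 0 = 0"
  by (simp add: catalan_def)

lemma catalan_1 [simp]: "catalan (Suc 0) = 1/4"
  by (simp add: catalan_def)

lemma catalan_Suc:
  assumes "n > 0"
  shows "catalan (Suc n) = catalan n * ((2 * real n - 1) / (2 * (real n + 1)))"
proof -
  have eq: "(1/2 gchoose Suc n) = (1/2 gchoose n) * ((1/2 - real n) / (real n + 1))"
    using gbinomial_mult_1[of "1/2 :: real" n] by (simp add: field_simps)
  show ?thesis
    unfolding catalan_def eq using assms by (simp add: field_simps)
qed

lemma catalan_pos: "n > 0 \<Longrightarrow> catalan n > 0"
proof (induction n)
  case (Suc n)
  then show ?case by (cases "n = 0") (auto simp: catalan_Suc intro!: mult_pos_pos divide_pos_pos)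
qed simp

lemma catalan_nonneg: "catalan n \<ge> 0"
  using catalan_pos[of n] by (cases "n = 0") auto

text \<open>The square of sqrt (1 - x) is 1 - x, which has no coefficients from degree 2 on.
  Vandermonde with 1/2 + 1/2 = 1 expresses this.\<close>

lemma conv_catalan:
  assumes "n \<ge> 2"
  shows "conv catalan catalan n = catalan n"
proof -
  \<comment> \<open>The coefficients of sqrt (1 - x), which is 1 minus twice the generating function
    of \<open>catalan\<close>.\<close>
  define c where "c n = (1/2 gchoose n) * (-1 :: real) ^ n" for n
  have c: "c n = (if n = 0 then 1 else 0) - 2 * catalan n" for n
    by (simp add: c_def catalan_def)
  have "(\<Sum>k\<le>n. c k * c (n - k)) = (\<Sum>k\<le>n. (1/2 gchoose k) * (1/2 gchoose (n - k)) * (-1) ^ n)"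
    by (intro sum.cong) (auto simp: c_def simp flip: power_add)
  also have "\<dots> = ((1 :: real) gchoose n) * (-1) ^ n"
    using gbinomial_Vandermonde[of "1/2 :: real" "1/2" n]
    by (simp add: atLeast0AtMost flip: sum_distrib_right)
  also have "(1 :: real) gchoose n = 0"
    using assms binomial_gbinomial[of 1 n, where ?'a = real] by (simp add: binomial_eq_0)
  finally have "(\<Sum>k\<le>n. c k * c (n - k)) = 0" by simp
  moreover have "c k * c (n - k) =
      (if k = 0 then - 2 * catalan n else 0) + (if k = n then - 2 * catalan n else 0)
      + 4 * (catalan k * catalan (n - k))" if "k \<le> n" for k
    using that assms by (auto simp: c)
  then have "(\<Sum>k\<le>n. c k * c (n - k)) = - 4 * catalan n + 4 * conv catalan catalan n"
    by (simp add: sum.distrib conv_def flip: sum_distrib_left)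
  ultimately show ?thesis by simp
qed

section \<open>Growth and sum of the normalized Catalan numbers\<close>

lemma catalan_asymptotic: "(\<lambda>n. catalan n * exp (3 / 2 * ln (real n))) \<longlonglongrightarrow> 1 / (4 * sqrt pi)"
proof -
  \<comment> \<open>The functional equation of Gamma at -1/2, away from the poles, gives the
    constant.\<close>
  have "- (1/2 :: real) \<notin> \<int>\<^sub>\<le>\<^sub>0"
  proof
    assume "- (1/2 :: real) \<in> \<int>\<^sub>\<le>\<^sub>0"
    then obtain m where "- (1/2 :: real) = - of_nat m"
      by (rule nonpos_Ints_cases')
    then have "real (2 * m) = real 1" by simp
    then show False unfolding of_nat_eq_iff by presburger
  qed
  from Gamma_plus1[OF this] have "Gamma (-1/2 :: real) = -2 * sqrt pi"
    by (simp add: Gamma_one_half_real)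
  then have "(\<lambda>n. - ((1/2 gchoose n) / ((-1)^n / exp ((1/2 + 1) * ln (real n)))) / 2)
      \<longlonglongrightarrow> - inverse (-2 * sqrt pi) / 2"
    using gbinomial_asymptotic[of "1/2 :: real"] by (intro tendsto_intros) auto
  then show ?thesis
  proof (rule Lim_transform_eventually[THEN tendsto_eq_rhs])
    show "\<forall>\<^sub>F n in sequentially. - ((1/2 gchoose n) / ((-1)^n / exp ((1/2 + 1) * ln (real n)))) / 2
        = catalan n * exp (3 / 2 * ln (real n))"
      using eventually_gt_at_top[of 0]
      by eventually_elim (auto simp: catalan_def field_simps minus_one_power_iff)
  qed (simp add: field_simps)
qed

lemma catalan_asymp_equiv: "catalan \<sim>[sequentially] (\<lambda>n. 1 / (4 * sqrt (pi * real n ^ 3)))"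
proof (rule asymp_equivI')
  have "(\<lambda>n. catalan n * exp (3 / 2 * ln (real n)) * (4 * sqrt pi)) \<longlonglongrightarrow> 1 / (4 * sqrt pi) * (4 * sqrt pi)"
    by (intro tendsto_intros catalan_asymptotic)
  then show "(\<lambda>n. catalan n / (1 / (4 * sqrt (pi * real n ^ 3)))) \<longlonglongrightarrow> 1"
  proof (rule Lim_transform_eventually[THEN tendsto_eq_rhs])
    show "\<forall>\<^sub>F n in sequentially. catalan n * exp (3 / 2 * ln (real n)) * (4 * sqrt pi)
        = catalan n / (1 / (4 * sqrt (pi * real n ^ 3)))"
      using eventually_gt_at_top[of 0]
    proof eventually_elim
      case (elim n)
      have "sqrt (real n ^ 3) = (real n ^ 3) powr (1/2)" by (simp add: powr_half_sqrt)
      also have "\<dots> = real n powr (3/2)"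
        using elim by (simp add: powr_powr flip: powr_numeral)
      also have "\<dots> = exp (3 / 2 * ln (real n))"
        using elim by (simp add: powr_def)
      finally show ?case by (simp add: real_sqrt_mult)
    qed
  qed simp
qed

lemma times_catalan_tendsto_0: "(\<lambda>n. (2 * real n - 1) * catalan n) \<longlonglongrightarrow> 0"
proof -
  have "(\<lambda>n. (2 * real n - 1) * (1 / (4 * sqrt (pi * real n ^ 3)))) \<longlonglongrightarrow> 0"
    by real_asymp
  moreover have "(\<lambda>n. (2 * real n - 1) * catalan n)
      \<sim>[sequentially] (\<lambda>n. (2 * real n - 1) * (1 / (4 * sqrt (pi * real n ^ 3))))"
    by (intro asymp_equiv_intros catalan_asymp_equiv)
  ultimately show ?thesis
    by (simp add: tendsto_asymp_equiv_cong)
qed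

lemma catalan_sums: "catalan sums (1/2)"
proof -
  \<comment> \<open>The recurrence makes \<open>(2 * n - 1) * catalan n\<close> drop by exactly
    \<open>catalan (n + 1)\<close> from \<open>n\<close> to \<open>n + 1\<close>, so the sum
    telescopes.\<close>
  have partial: "(\<Sum>k\<le>Suc n. catalan k) = 1/2 - (2 * real (Suc n) - 1) * catalan (Suc n)" for n
  proof (induction n)
    case (Suc n)
    have "(2 * real (Suc n) - 1) * catalan (Suc n) = 2 * (real (Suc n) + 1) * catalan (Suc (Suc n))"
      by (subst catalan_Suc) (auto simp: field_simps)
    with Suc show ?case by (simp add: algebra_simps)
  qed simp
  have "(\<lambda>n. 1/2 - (2 * real (Suc n) - 1) * catalan (Suc n)) \<longlonglongrightarrow> 1/2 - 0"
    by (intro tendsto_intros times_catalan_tendsto_0[THEN LIMSEQ_Suc])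
  then have "(\<lambda>n. \<Sum>k<Suc (Suc n). catalan k) \<longlonglongrightarrow> 1/2"
    unfolding partial[symmetric] lessThan_Suc_atMost by simp
  then show ?thesis
    unfolding sums_def
    by (intro LIMSEQ_imp_Suc[where f = "\<lambda>n. sum catalan {..<n}"]
        LIMSEQ_imp_Suc[where f = "\<lambda>n. sum catalan {..<Suc n}"])
qed

text \<open>The one-step ratio tends to 1 by the recurrence, and \<open>i\<close> such ratios are
  multiplied. A fixed shift is thus invisible asymptotically.\<close>

lemma catalan_ratio: "(\<lambda>n. catalan (n - i) / catalan n) \<longlonglongrightarrow> 1"
proof (induction i)
  case 0
  show ?case
    by (rule tendsto_eventually, use eventually_gt_at_top[of 0] in eventually_elim)
      (auto dest: catalan_pos)
next
  case (Suc i)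
  have "(\<lambda>n. catalan n / catalan (Suc n)) \<longlonglongrightarrow> 1"
  proof (rule Lim_transform_eventually)
    show "(\<lambda>n. 2 * (real n + 1) / (2 * real n - 1)) \<longlonglongrightarrow> 1" by real_asymp
    show "\<forall>\<^sub>F n in sequentially. 2 * (real n + 1) / (2 * real n - 1) = catalan n / catalan (Suc n)"
      using eventually_gt_at_top[of 0]
    proof eventually_elim
      case (elim n)
      then show ?case using catalan_pos[of n] by (simp add: catalan_Suc field_simps)
    qed
  qed
  then have "(\<lambda>n. catalan (n - Suc i) / catalan (Suc (n - Suc i))) \<longlonglongrightarrow> 1"
    by (rule filterlim_compose) (rule filterlim_minus_const_nat_at_top)
  from tendsto_mult[OF this Suc]
  have "(\<lambda>n. catalan (n - Suc i) / catalan (Suc (n - Suc i)) * (catalan (n - i) / catalan n)) \<longlonglongrightarrow> 1"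
    by simp
  then show ?case
  proof (rule Lim_transform_eventually)
    show "\<forall>\<^sub>F n in sequentially. catalan (n - Suc i) / catalan (Suc (n - Suc i)) * (catalan (n - i) / catalan n)
        = catalan (n - Suc i) / catalan n"
      using eventually_gt_at_top[of i]
    proof eventually_elim
      case (elim n)
      then show ?case using catalan_pos[of "n - i"] by (simp add: Suc_diff_Suc)
    qed
  qed
qed

subsection \<open>Subexponential convolutions\<close>

definition conv_mid :: "(nat \<Rightarrow> real) \<Rightarrow> (nat \<Rightarrow> real) \<Rightarrow> nat \<Rightarrow> nat \<Rightarrow> real" where
  "conv_mid a b k n = (\<Sum>i\<in>{k..n-k}. a i * b (n - i))"

text \<open>Since \<open>2 * k \<le> n\<close>, the two ends do not overlap; reflecting
  \<open>i\<close> to \<open>n - i\<close> brings the upper end into the form of the lower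
  one.\<close>

lemma conv_split:
  fixes a b :: "nat \<Rightarrow> real"
  assumes "2 * k \<le> n"
  shows "conv a b n = (\<Sum>i<k. a i * b (n - i)) + (\<Sum>i<k. b i * a (n - i)) + conv_mid a b k n"
proof -
  have "{..n} = {..<k} \<union> {n-k<..n} \<union> {k..n-k}" using assms by auto
  then have "conv a b n = (\<Sum>i\<in>{..<k} \<union> {n-k<..n} \<union> {k..n-k}. a i * b (n - i))"
    by (simp add: conv_def)
  also have "\<dots> = (\<Sum>i<k. a i * b (n - i)) + (\<Sum>i\<in>{n-k<..n}. a i * b (n - i)) + conv_mid a b k n"
    using assms by (subst sum.union_disjoint, simp, simp, force)+ (simp add: conv_mid_def)
  also have "(\<Sum>i\<in>{n-k<..n}. a i * b (n - i)) = (\<Sum>i<k. b i * a (n - i))"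
    using assms by (intro sum.reindex_bij_witness[where i = "\<lambda>i. n - i" and j = "\<lambda>i. n - i"]) auto
  finally show ?thesis .
qed

lemma conv_mid_bounds:
  assumes "\<And>n. 0 \<le> a n" "\<And>n. a n \<le> catalan n" "\<And>n. 0 \<le> b n" "\<And>n. b n \<le> catalan n"
  shows "0 \<le> conv_mid a b k n" "conv_mid a b k n \<le> conv_mid catalan catalan k n"
  using assms unfolding conv_mid_def
  by (auto intro!: sum_nonneg sum_mono mult_nonneg_nonneg mult_mono catalan_nonneg)

lemma partial_conv_limit:
  assumes "(\<lambda>n. b n / catalan n) \<longlonglongrightarrow> \<beta>"
  shows "(\<lambda>n. (\<Sum>i<k. a i * b (n - i)) / catalan n) \<longlonglongrightarrow> \<beta> * (\<Sum>i<k. a i)"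
proof -
  have "(\<lambda>n. b (n - i) / catalan (n - i)) \<longlonglongrightarrow> \<beta>" for i
    by (rule filterlim_compose[OF assms filterlim_minus_const_nat_at_top])
  then have "(\<lambda>n. \<Sum>i<k. a i * (b (n - i) / catalan (n - i) * (catalan (n - i) / catalan n))) \<longlonglongrightarrow>
      (\<Sum>i<k. a i * (\<beta> * 1))"
    by (intro tendsto_intros catalan_ratio)
  then have "(\<lambda>n. \<Sum>i<k. a i * (b (n - i) / catalan (n - i) * (catalan (n - i) / catalan n))) \<longlonglongrightarrow>
      \<beta> * (\<Sum>i<k. a i)"
    by (simp add: sum_distrib_left mult.commute)
  then show ?thesis
  proof (rule Lim_transform_eventually)
    show "\<forall>\<^sub>F n in sequentially. (\<Sum>i<k. a i * (b (n - i) / catalan (n - i) * (catalan (n - i) / catalan n)))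
        = (\<Sum>i<k. a i * b (n - i)) / catalan n"
      using eventually_gt_at_top[of k]
    proof eventually_elim
      case (elim n)
      show ?case
        unfolding sum_divide_distrib
      proof (intro sum.cong refl)
        fix i assume "i \<in> {..<k}"
        with elim show "a i * (b (n - i) / catalan (n - i) * (catalan (n - i) / catalan n)) = a i * b (n - i) / catalan n"
          using catalan_pos[of "n - i"] by simp
      qed
    qed
  qed
qed

text \<open>As \<open>catalan\<close> is its own convolution square from 2 on, the middle is what
  the two equal ends leave over.\<close>

lemma conv_mid_catalan_limit: "(\<lambda>n. conv_mid catalan catalan k n / catalan n) \<longlonglongrightarrow> 1 - 2 * (\<Sum>i<k. catalan i)"
proof -
  have "(\<lambda>n. 1 - 2 * ((\<Sum>i<k. catalan i * catalan (n - i)) / catalan n)) \<longlonglongrightarrow> 1 - 2 * (1 * (\<Sum>i<k. catalan i))"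
    using catalan_ratio[of 0] by (intro tendsto_intros partial_conv_limit) simp
  then have "(\<lambda>n. 1 - 2 * ((\<Sum>i<k. catalan i * catalan (n - i)) / catalan n)) \<longlonglongrightarrow> 1 - 2 * (\<Sum>i<k. catalan i)"
    by simp
  then show ?thesis
  proof (rule Lim_transform_eventually)
    show "\<forall>\<^sub>F n in sequentially. 1 - 2 * ((\<Sum>i<k. catalan i * catalan (n - i)) / catalan n) = conv_mid catalan catalan k n / catalan n"
      using eventually_ge_at_top[of "2 * k + 2"]
    proof eventually_elim
      case (elim n)
      then show ?case
        using conv_split[of k n catalan catalan] conv_catalan[of n] catalan_pos[of n] by (simp add: field_simps)
    qed
  qed
qed

lemma conv_mid_catalan_limit_tendsto_0: "(\<lambda>k. 1 - 2 * (\<Sum>i<k. catalan i)) \<longlonglongrightarrow> 0"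
proof -
  have "(\<lambda>k. 1 - 2 * (\<Sum>i<k. catalan i)) \<longlonglongrightarrow> 1 - 2 * (1/2)"
    using catalan_sums unfolding sums_def by (intro tendsto_intros)
  then show ?thesis by simp
qed

text \<open>First \<open>n\<close>, then \<open>k\<close> goes to infinity: \<open>y k\<close>
  approximates \<open>x\<close> up to an error whose limit in \<open>n\<close> vanishes as
  \<open>k\<close> grows.\<close>

lemma tendsto_iterated:
  fixes x :: "nat \<Rightarrow> real"
  assumes close: "\<And>k. \<forall>\<^sub>F n in sequentially. \<bar>x n - y k n\<bar> \<le> m k n"
    and y: "\<And>k. y k \<longlonglongrightarrow> Y k" "Y \<longlonglongrightarrow> l" and m: "\<And>k. m k \<longlonglongrightarrow> M k" "M \<longlonglongrightarrow> 0"
  shows "x \<longlonglongrightarrow> l"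
proof (rule LIMSEQ_I)
  fix e :: real assume "e > 0"
  have "(\<lambda>k. \<bar>Y k - l\<bar> + M k) \<longlonglongrightarrow> \<bar>l - l\<bar> + 0"
    by (intro tendsto_intros y m)
  then have "\<forall>\<^sub>F k in sequentially. \<bar>Y k - l\<bar> + M k < e"
    using \<open>e > 0\<close> by (intro order_tendstoD(2)[where y = "\<bar>l - l\<bar> + 0"]) auto
  then obtain k where k: "\<bar>Y k - l\<bar> + M k < e"
    by (auto simp: eventually_sequentially)
  have "(\<lambda>n. \<bar>y k n - l\<bar> + m k n) \<longlonglongrightarrow> \<bar>Y k - l\<bar> + M k"
    by (intro tendsto_intros y m)
  from order_tendstoD(2)[OF this k] close[of k]
  have "\<forall>\<^sub>F n in sequentially. norm (x n - l) < e"
    by eventually_elim auto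
  then show "\<exists>N. \<forall>n\<ge>N. norm (x n - l) < e"
    by (simp add: eventually_sequentially)
qed

text \<open>For fixed \<open>k\<close> the two ends have limits, and the middle is dominated by that
  of \<open>catalan\<close> with itself, which becomes negligible as \<open>k\<close> grows.\<close>

lemma conv_limit:
  assumes a: "\<And>n. 0 \<le> a n" "\<And>n. a n \<le> catalan n" "a sums A" "(\<lambda>n. a n / catalan n) \<longlonglongrightarrow> \<alpha>"
    and b: "\<And>n. 0 \<le> b n" "\<And>n. b n \<le> catalan n" "b sums B" "(\<lambda>n. b n / catalan n) \<longlonglongrightarrow> \<beta>"
  shows "(\<lambda>n. conv a b n / catalan n) \<longlonglongrightarrow> \<beta> * A + \<alpha> * B"
proof (rule tendsto_iterated)
  fix k
  show "(\<lambda>n. (\<Sum>i<k. a i * b (n - i)) / catalan n + (\<Sum>i<k. b i * a (n - i)) / catalan n)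
      \<longlonglongrightarrow> \<beta> * (\<Sum>i<k. a i) + \<alpha> * (\<Sum>i<k. b i)"
    by (intro tendsto_intros partial_conv_limit a b)
  show "(\<lambda>n. conv_mid catalan catalan k n / catalan n) \<longlonglongrightarrow> 1 - 2 * (\<Sum>i<k. catalan i)"
    by (rule conv_mid_catalan_limit)
  show "\<forall>\<^sub>F n in sequentially. \<bar>conv a b n / catalan n -
      ((\<Sum>i<k. a i * b (n - i)) / catalan n + (\<Sum>i<k. b i * a (n - i)) / catalan n)\<bar>
        \<le> conv_mid catalan catalan k n / catalan n"
    using eventually_ge_at_top[of "2 * k"]
  proof eventually_elim
    case (elim n)
    have "conv a b n / catalan n -
          ((\<Sum>i<k. a i * b (n - i)) / catalan n + (\<Sum>i<k. b i * a (n - i)) / catalan n)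
        = conv_mid a b k n / catalan n"
      using elim by (simp add: conv_split add_divide_distrib)
    also have "\<bar>\<dots>\<bar> \<le> conv_mid catalan catalan k n / catalan n"
      using conv_mid_bounds[of a b k n] a b catalan_nonneg[of n] by (auto simp: divide_right_mono)
    finally show ?case .
  qed
next
  show "(\<lambda>k. \<beta> * (\<Sum>i<k. a i) + \<alpha> * (\<Sum>i<k. b i)) \<longlonglongrightarrow> \<beta> * A + \<alpha> * B"
    using a b unfolding sums_def by (intro tendsto_intros)
qed (rule conv_mid_catalan_limit_tendsto_0)

subsection \<open>Asymptotics of the truth-table counts\<close>

definition row_ratio :: "bool \<Rightarrow> nat \<Rightarrow> real" where
  "row_ratio b n = real (row_count b n) / 8 ^ n"

lemma row_ratio_nonneg: "row_ratio b n \<ge> 0"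
  by (simp add: row_ratio_def)

lemma row_ratio_0 [simp]: "row_ratio b 0 = 0"
  by (simp add: row_ratio_def)

lemma row_ratio_1 [simp]: "row_ratio b (Suc 0) = 1/8"
  by (simp add: row_ratio_def)

lemma conv_scale:
  fixes c :: "'a::field"
  assumes "c \<noteq> 0"
  shows "conv (\<lambda>k. a k / c ^ k) (\<lambda>k. b k / c ^ k) n = conv a b n / c ^ n"
  using assms by (auto simp: conv_def sum_divide_distrib power_diff intro!: sum.cong)

lemma of_nat_conv: "of_nat (conv a b n) = conv (\<lambda>k. of_nat (a k)) (\<lambda>k. of_nat (b k)) n"
  by (simp add: conv_def)

lemma conv_row_ratio:
  "conv (row_ratio p) (row_ratio q) n = real (conv (row_count p) (row_count q) n) / 8 ^ n"
  unfolding row_ratio_def[abs_def] by (simp add: conv_scale of_nat_conv)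

lemma row_ratio_total: "row_ratio True n + row_ratio False n = catalan n"
proof (induction n rule: less_induct)
  case (less n)
  define G where "G k = row_count True k + row_count False k" for k
  consider "n = 0" | "n = 1" | "n \<ge> 2" by linarith
  then show ?case
  proof cases
    case 3
    have "row_ratio True n + row_ratio False n = real (conv G G n) / 8 ^ n"
      using row_count_total[OF 3] by (simp add: row_ratio_def G_def[abs_def] flip: add_divide_distrib of_nat_add)
    also have "\<dots> = conv (\<lambda>k. real (G k) / 8 ^ k) (\<lambda>k. real (G k) / 8 ^ k) n"
      by (simp add: conv_scale of_nat_conv)
    also have "\<dots> = conv catalan catalan n"
      unfolding conv_def
    proof (intro sum.cong refl)
      fix k assume "k \<in> {..n}"
      have eq: "real (G k) / 8 ^ k = catalan k" if "k < n" for k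
        using less[OF that] by (simp add: G_def row_ratio_def add_divide_distrib)
      show "real (G k) / 8 ^ k * (real (G (n - k)) / 8 ^ (n - k)) = catalan k * catalan (n - k)"
      \<comment> \<open>At the ends one index is \<open>n\<close>, outside the induction hypothesis,
        but the factor at index 0 makes both sides 0.\<close>
      proof (cases "k = 0 \<or> k = n")
        case False
        with \<open>k \<in> {..n}\<close> have "k < n" "n - k < n" by auto
        then show ?thesis by (simp only: eq)
      qed (auto simp: G_def)
    qed
    finally show ?thesis using conv_catalan[OF 3] by simp
  qed auto
qed

lemma row_ratio_le_catalan: "row_ratio b n \<le> catalan n"
  using row_ratio_total[of n] row_ratio_nonneg[of True n] row_ratio_nonneg[of False n]
  by (cases b) auto

lemma row_ratio_False: "n \<ge> 2 \<Longrightarrow> row_ratio False n = conv (row_ratio True) (row_ratio True) n"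
  by (simp add: conv_row_ratio row_count_False row_ratio_def)

lemma summable_row_ratio: "summable (row_ratio b)"
  by (rule summable_comparison_test[OF _ sums_summable[OF catalan_sums]])
    (auto simp: row_ratio_nonneg row_ratio_le_catalan)

lemma row_ratio_True_sums: "row_ratio True sums ((sqrt 10 - 2) / 4)"
proof -
  let ?t = "row_ratio True"
  define S where "S = suminf ?t"
  have t: "?t sums S"
    unfolding S_def by (intro summable_sums summable_row_ratio)
  have nt: "summable (\<lambda>n. norm (?t n))"
    using summable_row_ratio by (simp add: row_ratio_nonneg)
  have "(\<lambda>n. conv ?t ?t n) sums (S * S)"
    unfolding conv_def S_def by (rule Cauchy_product_sums[OF nt nt])
  \<comment> \<open>The correction repairs \<open>n = 1\<close>, where the false row has weight 1/8
    but the convolution is 0.\<close>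
  then have "(\<lambda>n. ?t n + conv ?t ?t n + (if n = 1 then 1/8 else 0)) sums (S + S * S + 1/8)"
    by (intro sums_add t sums_single)
  moreover have "?t n + conv ?t ?t n + (if n = 1 then 1/8 else 0) = catalan n" for n
  proof -
    consider "n = 0" | "n = 1" | "n \<ge> 2" by linarith
    then show ?thesis
      using row_ratio_total[of n] by cases (simp_all add: conv_def row_ratio_False)
  qed
  ultimately have "catalan sums (S + S * S + 1/8)" by simp
  then have "S + S * S + 1/8 = 1/2"
    using catalan_sums by (rule sums_unique2)
  \<comment> \<open>Completing the square; nonnegativity of \<open>S\<close> then selects the
    root.\<close>
  then have "(4 * S + 2)\<^sup>2 = 10"
    by (simp add: power2_eq_square algebra_simps)
  moreover have "S \<ge> 0"
    unfolding S_def by (intro suminf_nonneg summable_row_ratio row_ratio_nonneg)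
  ultimately have "sqrt 10 = 4 * S + 2"
    by (intro real_sqrt_unique) auto
  then have "S = (sqrt 10 - 2) / 4" by simp
  with t show ?thesis by simp
qed

lemma row_ratio_True_limit: "(\<lambda>n. row_ratio True n / catalan n) \<longlonglongrightarrow> 2 / sqrt 10"
proof -
  let ?t = "row_ratio True"
  define S where "S = (sqrt 10 - 2) / 4"
  define l where "l = 2 / sqrt 10"
  define d where "d n = ?t n / catalan n - l" for n
  \<comment> \<open>The upper bound 7/2 yields \<open>2 * S < 3/4\<close>, the contraction factor;
    the lower bound 3 keeps \<open>S\<close> nonnegative and \<open>l\<close> at most 1.\<close>
  have "3 < sqrt 10" by (rule real_less_rsqrt) simp
  moreover have "sqrt 10 < 7/2" by (rule real_less_lsqrt) (simp_all add: power2_eq_square)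
  ultimately have S: "0 \<le> S" "S < 3/8" and l: "0 \<le> l" "l \<le> 1"
    by (auto simp: S_def l_def)
  have lS: "l + 2 * l * S = 1"
    by (simp add: l_def S_def field_simps)
  \<comment> \<open>The two ends of \<open>t * t\<close> contribute \<open>2 S d\<close> to \<open>d\<close>, and \<open>2 S < 3/4\<close>.\<close>
  have step: "\<forall>\<^sub>F n in sequentially. \<bar>d n\<bar> \<le> 3/4 * c"
    if "c > 0" and d: "\<forall>\<^sub>F n in sequentially. \<bar>d n\<bar> \<le> c" for c
  proof -
    let ?A = "\<lambda>k. \<Sum>i<k. ?t i"
    let ?W = "\<lambda>k n. (\<Sum>i<k. ?t i * catalan (n - i)) / catalan n"
    \<comment> \<open>As \<open>k\<close> grows, the error bound tends to \<open>2 * c * S\<close>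
      because \<open>l\<close> solves the limit equation. The gap between \<open>2 * S\<close> and
      3/4 lets a finite \<open>k\<close> suffice.\<close>
    have "(\<lambda>k. \<bar>1 - l - 2 * l * ?A k\<bar> + 2 * (c * ?A k) + (1 - 2 * (\<Sum>i<k. catalan i)))
        \<longlonglongrightarrow> \<bar>1 - l - 2 * l * S\<bar> + 2 * (c * S) + 0"
      using row_ratio_True_sums unfolding sums_def S_def
      by (intro tendsto_intros conv_mid_catalan_limit_tendsto_0)
    moreover have "\<bar>1 - l - 2 * l * S\<bar> + 2 * (c * S) + 0 < 3/4 * c"
    proof -
      have "c * S < c * (3/8)" using S(2) \<open>c > 0\<close> by (rule mult_strict_left_mono)
      then show ?thesis using lS by simp
    qed
    ultimately have "\<forall>\<^sub>F k in sequentially.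
        \<bar>1 - l - 2 * l * ?A k\<bar> + 2 * (c * ?A k) + (1 - 2 * (\<Sum>i<k. catalan i)) < 3/4 * c"
      by (rule order_tendstoD(2))
    then obtain k where k: "\<bar>1 - l - 2 * l * ?A k\<bar> + 2 * (c * ?A k) + (1 - 2 * (\<Sum>i<k. catalan i)) < 3/4 * c"
      by (auto simp: eventually_sequentially)
    \<comment> \<open>With \<open>k\<close> fixed, \<open>n\<close> goes to infinity, so the same
      strict bound holds eventually for the finite-\<open>n\<close> expressions.\<close>
    have "?W k \<longlonglongrightarrow> 1 * ?A k"
      using catalan_ratio[of 0] by (intro partial_conv_limit) simp
    then have "(\<lambda>n. \<bar>1 - l - 2 * l * ?W k n\<bar> + 2 * (c * ?W k n) +
          conv_mid catalan catalan k n / catalan n)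
        \<longlonglongrightarrow> \<bar>1 - l - 2 * l * ?A k\<bar> + 2 * (c * ?A k) + (1 - 2 * (\<Sum>i<k. catalan i))"
      by (intro tendsto_intros conv_mid_catalan_limit) simp_all
    from order_tendstoD(2)[OF this k]
    have small: "\<forall>\<^sub>F n in sequentially.
        \<bar>1 - l - 2 * l * ?W k n\<bar> + 2 * (c * ?W k n) +
          conv_mid catalan catalan k n / catalan n < 3/4 * c" .
    from d obtain N where N: "\<And>n. n \<ge> N \<Longrightarrow> \<bar>d n\<bar> \<le> c"
      by (auto simp: eventually_sequentially)
    show ?thesis
      \<comment> \<open>\<open>2 * k\<close> permits the split, \<open>N\<close> makes the bound on
        \<open>d\<close> available at \<open>n - i\<close> for \<open>i < k\<close>, and 2 starts
        the recurrence.\<close>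
      using small eventually_ge_at_top[of "2 * k + N + 2"]
    proof eventually_elim
      case (elim n)
      then have n: "2 * k \<le> n" "n \<ge> 2" "catalan n > 0" and nN: "\<And>i. i < k \<Longrightarrow> N \<le> n - i"
        by (auto intro: catalan_pos)
      define D where "D = (\<Sum>i<k. ?t i * (catalan (n - i) * d (n - i)))"
      have "\<bar>D\<bar> \<le> (\<Sum>i<k. ?t i * (catalan (n - i) * c))"
        unfolding D_def using N nN
        by (intro order.trans[OF sum_abs] sum_mono)
          (auto simp: abs_mult row_ratio_nonneg catalan_nonneg intro!: mult_left_mono)
      then have "\<bar>D\<bar> / catalan n \<le> c * ?W k n"
        using n by (simp add: divide_right_mono sum_distrib_left mult_ac)
      \<comment> \<open>Substitutes \<open>catalan * (d + l)\<close> for the second factor,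
        separating the deviation \<open>D\<close> from the main term.\<close>
      have "?t i * ?t (n - i) = ?t i * (catalan (n - i) * d (n - i)) + l * (?t i * catalan (n - i))"
        if "i < k" for i
        using catalan_pos[of "n - i"] that n by (simp add: d_def field_simps)
      then have "(\<Sum>i<k. ?t i * ?t (n - i)) = D + l * (\<Sum>i<k. ?t i * catalan (n - i))"
        by (simp add: D_def sum.distrib sum_distrib_left)
      then have "?t n = catalan n - 2 * D - 2 * l * (\<Sum>i<k. ?t i * catalan (n - i)) - conv_mid ?t ?t k n"
        using row_ratio_total[of n] row_ratio_False[OF n(2)] conv_split[OF n(1), of ?t ?t] by simp
      then have d_eq: "d n = (1 - l - 2 * l * ?W k n) - 2 * (D / catalan n) - conv_mid ?t ?t k n / catalan n"
        using n by (simp add: d_def diff_divide_distrib)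
      have mid: "0 \<le> conv_mid ?t ?t k n / catalan n"
          "conv_mid ?t ?t k n / catalan n \<le> conv_mid catalan catalan k n / catalan n"
        using conv_mid_bounds[of ?t ?t k n] n
        by (auto simp: row_ratio_nonneg row_ratio_le_catalan divide_right_mono)
      have D: "\<bar>D / catalan n\<bar> \<le> c * ?W k n"
        using \<open>\<bar>D\<bar> / catalan n \<le> c * ?W k n\<close> n by simp
      have "\<bar>x\<bar> \<le> q" if "x = u - 2 * z - m" "0 \<le> m" "m \<le> M" "\<bar>z\<bar> \<le> y" "\<bar>u\<bar> + 2 * y + M < q"
        for x u z m M y q :: real
        using that by linarith
      from this[OF d_eq mid D elim(1)] show "\<bar>d n\<bar> \<le> 3/4 * c" .
    qed
  qed
  \<comment> \<open>Iterates the contraction from the trivial bound 1, as both the quotient and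
    \<open>l\<close> lie in [0, 1]; at \<open>n = 0\<close> the quotient is 0 by convention.\<close>
  have bound: "\<forall>\<^sub>F n in sequentially. \<bar>d n\<bar> \<le> (3/4) ^ m" for m
  proof (induction m)
    case 0
    have "\<bar>d n\<bar> \<le> 1" for n
    proof -
      have "0 \<le> ?t n / catalan n" "?t n / catalan n \<le> 1"
        using row_ratio_nonneg[of True n] row_ratio_le_catalan[of True n] catalan_nonneg[of n]
        by (auto simp: divide_le_eq_1)
      with l show ?thesis unfolding d_def by linarith
    qed
    then show ?case by simp
  next
    case (Suc m)
    then show ?case using step[of "(3/4) ^ m"] by simp
  qed
  have "d \<longlonglongrightarrow> 0"
  proof (rule tendstoI)
    fix e :: real assume "e > 0"
    then obtain m where m: "(3/4 :: real) ^ m < e"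
      using real_arch_pow_inv[of e "3/4"] by auto
    from bound[of m] show "\<forall>\<^sub>F n in sequentially. dist (d n) 0 < e"
      by eventually_elim (use m in auto)
  qed
  then have "(\<lambda>n. d n + l) \<longlonglongrightarrow> 0 + l" by (intro tendsto_intros)
  then show ?thesis by (simp add: d_def l_def)
qed

text \<open>\<open>conv_limit\<close> for false and true rows: with S the sum and l the limit ratio
  of the true rows, the false ones have 1/2 - S and 1 - l.\<close>

lemma d_case2_limit:
  "(\<lambda>n. real (d_case2 n) / 8 ^ n / catalan n) \<longlonglongrightarrow> (11 * sqrt 10 - 30) / 20"
proof -
  let ?t = "row_ratio True" and ?f = "row_ratio False"
  have f: "?f n = catalan n - ?t n" for n
    using row_ratio_total[of n] by simp
  have "?f sums (1/2 - (sqrt 10 - 2) / 4)"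
    unfolding f[abs_def] by (intro sums_diff catalan_sums row_ratio_True_sums)
  moreover have "(\<lambda>n. ?f n / catalan n) \<longlonglongrightarrow> 1 - 2 / sqrt 10"
    using tendsto_diff[OF catalan_ratio[of 0] row_ratio_True_limit]
    by (simp add: f diff_divide_distrib)
  ultimately have "(\<lambda>n. conv ?f ?t n / catalan n) \<longlonglongrightarrow>
      2 / sqrt 10 * (1/2 - (sqrt 10 - 2) / 4) + (1 - 2 / sqrt 10) * ((sqrt 10 - 2) / 4)"
    by (intro conv_limit row_ratio_nonneg row_ratio_le_catalan row_ratio_True_sums row_ratio_True_limit)
  moreover have "2 / sqrt 10 * (1/2 - (sqrt 10 - 2) / 4) + (1 - 2 / sqrt 10) * ((sqrt 10 - 2) / 4)
      = (11 * sqrt 10 - 30) / 20"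
    by (simp add: field_simps)
  moreover have "real (d_case2 n) / 8 ^ n = conv ?f ?t n" for n
    by (simp add: conv_row_ratio d_case2_conv)
  ultimately show ?thesis by (simp only:)
qed

theorem theorem7p4:
  shows "(\<lambda>n. real (d_case2 n)) \<sim>[sequentially]
    (\<lambda>n. ((11 * sqrt 10 - 30) / 20) * (2 ^ (3 * n - 2) / sqrt (pi * real n ^ 3)))"
proof -
  define K :: real where "K = (11 * sqrt 10 - 30) / 20"
  \<comment> \<open>A nonzero constant is needed to turn the limit into an asymptotic
    equivalence.\<close>
  have "(30/11)\<^sup>2 < (10 :: real)" by (simp add: power2_eq_square)
  then have "30/11 < sqrt 10" by (rule real_less_rsqrt)
  then have K: "K \<noteq> 0" by (simp add: K_def)
  have "(\<lambda>n. real (d_case2 n) / 8 ^ n / catalan n) \<sim>[sequentially] (\<lambda>_. K)"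
    unfolding K_def[symmetric] using d_case2_limit K
    by (simp add: K_def tendsto_imp_asymp_equiv_const)
  then have "(\<lambda>n. real (d_case2 n) / 8 ^ n / catalan n * catalan n * 8 ^ n) \<sim>[sequentially]
      (\<lambda>n. K * (1 / (4 * sqrt (pi * real n ^ 3))) * 8 ^ n)"
    by (intro asymp_equiv_intros catalan_asymp_equiv)
  moreover have "\<forall>\<^sub>F n in sequentially.
      real (d_case2 n) / 8 ^ n / catalan n * catalan n * 8 ^ n = real (d_case2 n)"
    using eventually_gt_at_top[of 0] by eventually_elim (auto dest: catalan_pos)
  moreover have "\<forall>\<^sub>F n in sequentially. K * (1 / (4 * sqrt (pi * real n ^ 3))) * 8 ^ n
      = K * (2 ^ (3 * n - 2) / sqrt (pi * real n ^ 3))"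
    using eventually_gt_at_top[of 0]
  proof eventually_elim
    case (elim n)
    have "(8 :: real) ^ n = 2 ^ (3 * n)" by (simp add: power_mult)
    also have "\<dots> = 2 ^ (3 * n - 2) * 2\<^sup>2"
    proof -
      \<comment> \<open>The truncated subtraction is exact because \<open>n > 0\<close>; the factor
        4 cancels the one from \<open>catalan\<close>.\<close>
      have "3 * n - 2 + 2 = 3 * n" using elim by simp
      then show ?thesis by (simp only: flip: power_add)
    qed
    finally show ?case by simp
  qed
  ultimately show ?thesis
    unfolding K_def[symmetric] by (rule asymp_equiv_transfer)
qed

end
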